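(* Let $S$ be a compact and convex subset of $\mathbb R^K$ and let $h:S\to\mathbb R^K$ be a continuous function. Let $(a_n)_{n=0}^\infty$ be a nonincreasing sequence of positive real numbers satisfying $$0<\liminf_{n\to\infty} n a_n\le\limsup_{n\to\infty} n a_n<\infty .$$ Let $(\gamma_n)_{n=0}^\infty$ be a sequence in $\mathbb R^K$ which is Cesaro negligible, i.e. $\frac1n\sum_{i=0}^n\gamma_i\to 0$ as $n\to\infty$. Let $(x_n)_{n=0}^\infty$ be a sequence taking values in $S$ and satisfying, for all $n\ge0$, $$x_{n+1}=x_n+a_nh(x_n)+a_n\gamma_n .$$ If the ODE $\dot x=h(x)$ has a unique solution $z:\mathbb R\to S$ (i.e. there is exactly one function $z:\mathbb R\to S$, defined on all of $\mathbb R$ and with values in $S$, with $\dot z(t)=h(z(t))$ for all $t\in\mathbb R$), then $\lim_{n\to\infty}x_n=z(0)$. *)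

theory Defs
  imports "HOL-Analysis.Analysis"
begin

(* The value of the quotient at n = 0 (where x / 0 = 0) does not affect the limit.
   The sum has n + 1 terms but is divided by n. *)
definition cesaro_negligible :: "(nat \<Rightarrow> 'a::real_normed_vector) \<Rightarrow> bool" where
  "cesaro_negligible \<gamma> \<longleftrightarrow> (\<lambda>n. (1 / real n) *\<^sub>R (\<Sum>i=0..n. \<gamma> i)) \<longlonglongrightarrow> 0"

(* A function h : S -> R^K is represented by a total function; only its values on S matter
   here, because z takes values in S. *)
definition global_ode_solution ::
    "'a::real_normed_vector set \<Rightarrow> ('a \<Rightarrow> 'a) \<Rightarrow> (real \<Rightarrow> 'a) \<Rightarrow> bool" where
  "global_ode_solution S h z \<longleftrightarrow>
     (\<forall>t. z t \<in> S) \<and> (\<forall>t. (z has_vector_derivative h (z t)) (at t))"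

end

theory Submission
  imports Defs
begin

text \<open>
  Run the sequence on the clock \<open>\<tau> n = (\<Sum>i<n. a i)\<close>: then \<open>x\<close> is an Euler scheme for
  \<open>\<dot>x = h(x)\<close> with vanishing steps and a noise term. The lower bound on \<open>n * a n\<close> makes the
  clock run to infinity, and the upper bound makes the steps vanish.

  The noise is harmless because summation by parts turns Cesaro averages of \<open>\<gamma>\<close> into
  weighted sums \<open>\<Sum> a i * \<gamma> i\<close>: if the partial sums of \<open>\<gamma>\<close> up to \<open>k\<close> are at most \<open>\<epsilon> * k\<close>, then over
  any late window of bounded clock length the weighted sum is \<open>O(\<epsilon>)\<close>
  (\<open>weighted_sum_bound\<close>, \<open>discounted_noise_window\<close>). Hence, viewed as a step function of
  clock time, the process satisfies the first-order Taylor estimate of a solution of the ODE up to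
  an error that vanishes as time goes to infinity (\<open>noisy_euler_pseudotrajectory\<close>).

  Suppose now that \<open>x\<close> converges to \<open>y\<close> along a subsequence. Shift the step function so that the times
  of this subsequence are moved to time \<open>0\<close>. Since these times go to infinity, at any two
  fixed times, negative ones included, the shifted functions satisfy the estimate with
  an error tending to \<open>0\<close>. By compactness they have a cluster point, which satisfies the estimate
  without the error, so it is a solution on the
  whole real line, and its value at \<open>0\<close> is \<open>y\<close> (\<open>limit_point_of_pseudotrajectory_on_solution\<close>).
  By uniqueness that solution is \<open>z\<close>, so \<open>y = z 0\<close>. A sequence in a compact set with only one
  limit point converges to it.
\<close>

section \<open>Limit points of asymptotic solutions lie on full solutions\<close>

text \<open>
  The additive error \<open>\<eta>\<close> is what allows \<open>Y\<close> to be a step function: the jumps need only become small at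
  late times. The window length \<open>\<delta>\<close> is chosen before \<open>\<eta>\<close>, so it survives letting \<open>\<eta>\<close>
  tend to \<open>0\<close>, and in the limit the estimate says that \<open>h (Y s)\<close> is the right derivative at \<open>s\<close>.
\<close>

definition euler_pseudotrajectory :: "('a::real_normed_vector \<Rightarrow> 'a) \<Rightarrow> (real \<Rightarrow> 'a) \<Rightarrow> bool" where
  "euler_pseudotrajectory h Y \<longleftrightarrow>
     (\<forall>\<epsilon>>0. \<exists>\<delta>>0. \<forall>\<eta>>0. \<forall>\<^sub>F s in at_top. \<forall>t\<in>{s..s + \<delta>}.
        norm (Y t - Y s - (t - s) *\<^sub>R h (Y s)) \<le> \<epsilon> * (t - s) + \<eta>)"

text \<open>
  The cluster point of the time shifts is taken in the topology of pointwise convergence, where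
  compactness is Tychonoff's theorem. Pointwise convergence suffices: the Taylor estimate for
  fixed times \<open>s\<close> and \<open>t\<close> involves only two values of the function.
\<close>
lemma limit_point_of_pseudotrajectory_on_solution:
  fixes Y :: "real \<Rightarrow> 'a::real_normed_vector"
  assumes S: "compact S" and h: "continuous_on S h"
    and Y: "euler_pseudotrajectory h Y" and YS: "\<And>t. Y t \<in> S"
    and u: "filterlim u at_top sequentially" and y: "(\<lambda>k. Y (u k)) \<longlonglongrightarrow> y"
  shows "\<exists>z. global_ode_solution S h z \<and> z 0 = y"
proof -
  define \<Phi> where "\<Phi> = (\<lambda>(k::nat) t. Y (u k + t))"
  have "compactin (product_topology (\<lambda>_::real. euclidean) UNIV) (PiE UNIV (\<lambda>_. S))"
    using S by (subst compactin_PiE) auto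
  then have "compact (PiE UNIV (\<lambda>_::real. S))"
    by (metis compactin_euclidean_iff euclidean_product_topology)
  moreover have "filtermap \<Phi> sequentially \<noteq> bot"
    by (simp add: filtermap_bot_iff)
  moreover have "eventually (\<lambda>w. w \<in> PiE UNIV (\<lambda>_. S)) (filtermap \<Phi> sequentially)"
    by (intro eventually_filtermap[THEN iffD2] always_eventually allI) (simp add: \<Phi>_def PiE_UNIV_domain YS)
  ultimately obtain z where zPi: "z \<in> PiE UNIV (\<lambda>_. S)"
    and nb: "inf (nhds z) (filtermap \<Phi> sequentially) \<noteq> bot"
    unfolding compact_filter by blast
  \<comment> \<open>Along \<open>G\<close>, functions converge pointwise to \<open>z\<close> and inherit whatever holds for all late shifts.\<close>
  define G where "G = inf (nhds z) (filtermap \<Phi> sequentially)"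
  have G: "G \<noteq> bot" using nb by (simp add: G_def)
  have evG: "eventually P G" if "\<forall>\<^sub>F k in sequentially. P (\<Phi> k)" for P
  proof (rule filter_leD)
    show "G \<le> filtermap \<Phi> sequentially" by (simp add: G_def)
  qed (use that in \<open>simp add: eventually_filtermap\<close>)
  have lim: "((\<lambda>w. w t) \<longlongrightarrow> z t) G" for t
  proof (rule tendsto_mono)
    show "G \<le> nhds z" by (simp add: G_def)
    show "((\<lambda>w. w t) \<longlongrightarrow> z t) (nhds z)"
      by (rule continuous_on_tendsto_compose[OF continuous_on_product_coordinates filterlim_ident])
        simp_all
  qed
  have zS: "z t \<in> S" for t using zPi by auto
  have limh: "((\<lambda>w. h (w t)) \<longlongrightarrow> h (z t)) G" for t
    using continuous_on_tendsto_compose[OF h lim zS] by (simp add: evG \<Phi>_def YS)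
  have z0: "z 0 = y"
  proof (rule tendsto_unique[OF G lim])
    have "((\<lambda>w. w 0) \<longlongrightarrow> y) (filtermap \<Phi> sequentially)"
      using y by (simp add: filterlim_filtermap \<Phi>_def)
    then show "((\<lambda>w. w 0) \<longlongrightarrow> y) G"
      by (rule tendsto_mono[rotated]) (simp add: G_def)
  qed
  have est: "\<exists>\<delta>>0. \<forall>s. \<forall>t\<in>{s..s + \<delta>}. norm (z t - z s - (t - s) *\<^sub>R h (z s)) \<le> \<epsilon> * (t - s)"
    if "\<epsilon> > 0" for \<epsilon>
  proof -
    obtain \<delta> where "\<delta> > 0" and \<delta>: "\<And>\<eta>. \<eta> > 0 \<Longrightarrow> \<forall>\<^sub>F s in at_top. \<forall>t\<in>{s..s + \<delta>}.
        norm (Y t - Y s - (t - s) *\<^sub>R h (Y s)) \<le> \<epsilon> * (t - s) + \<eta>"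
      using Y \<open>\<epsilon> > 0\<close> unfolding euler_pseudotrajectory_def by blast
    have "norm (z t - z s - (t - s) *\<^sub>R h (z s)) \<le> \<epsilon> * (t - s)" if t: "t \<in> {s..s + \<delta>}" for s t
    proof (rule field_le_epsilon)
      fix \<eta> :: real assume "\<eta> > 0"
      have "filterlim (\<lambda>k. s + u k) at_top sequentially"
        by (rule filterlim_tendsto_add_at_top[OF tendsto_const u])
      from eventually_compose_filterlim[OF \<delta>[OF \<open>\<eta> > 0\<close>] this]
      have "\<forall>\<^sub>F k in sequentially.
          norm (\<Phi> k t - \<Phi> k s - (t - s) *\<^sub>R h (\<Phi> k s)) \<le> \<epsilon> * (t - s) + \<eta>"
      proof eventually_elim
        case (elim k)
        then show ?case using t elim[rule_format, of "u k + t"] by (simp add: \<Phi>_def add.commute)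
      qed
      then have ev: "\<forall>\<^sub>F w in G. norm (w t - w s - (t - s) *\<^sub>R h (w s)) \<le> \<epsilon> * (t - s) + \<eta>"
        by (rule evG)
      show "norm (z t - z s - (t - s) *\<^sub>R h (z s)) \<le> \<epsilon> * (t - s) + \<eta>"
        by (rule tendsto_upperbound[OF _ ev G]) (intro tendsto_intros lim limh)
    qed
    then show ?thesis using \<open>\<delta> > 0\<close> by blast
  qed
  obtain M where M: "M > 0" "\<And>v. v \<in> S \<Longrightarrow> norm (h v) \<le> M"
    using compact_imp_bounded[OF compact_continuous_image[OF h S]] by (auto simp: bounded_pos)
  obtain \<delta>1 where \<delta>1: "\<delta>1 > 0"
    "\<And>s t. t \<in> {s..s + \<delta>1} \<Longrightarrow> norm (z t - z s - (t - s) *\<^sub>R h (z s)) \<le> 1 * (t - s)"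
    using est[of 1] by auto
  \<comment> \<open>The estimate for \<open>\<epsilon> = 1\<close> already gives a local Lipschitz bound, hence continuity of \<open>z\<close>.\<close>
  have lip_forward: "dist (z s) (z t) \<le> (M + 1) * (t - s)" if "t \<in> {s..s + \<delta>1}" for s t
  proof -
    have "norm (z t - z s) \<le> norm (z t - z s - (t - s) *\<^sub>R h (z s)) + norm ((t - s) *\<^sub>R h (z s))"
      using norm_triangle_sub[of "z t - z s" "(t - s) *\<^sub>R h (z s)"] by simp
    also have "\<dots> \<le> 1 * (t - s) + (t - s) * M"
      using that by (intro add_mono \<delta>1) (auto intro!: mult_left_mono M zS)
    finally show ?thesis by (simp add: dist_norm norm_minus_commute algebra_simps)
  qed
  have lip: "dist (z s) (z t) \<le> (M + 1) * \<bar>t - s\<bar>" if "\<bar>t - s\<bar> \<le> \<delta>1" for s t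
    using that lip_forward[of t s] lip_forward[of s t] by (cases "s \<le> t") (auto simp: dist_commute)
  have "isCont z s" for s
  proof -
    have "\<forall>\<^sub>F t in at s. \<bar>t - s\<bar> < \<delta>1"
      using eventually_at_ball[OF \<delta>1(1), of s UNIV] by eventually_elim (auto simp: dist_real_def)
    then have ev: "\<forall>\<^sub>F t in at s. norm (dist (z s) (z t)) \<le> (M + 1) * \<bar>t - s\<bar>"
      by eventually_elim (simp add: lip)
    have "((\<lambda>t. (M + 1) * \<bar>t - s\<bar>) \<longlongrightarrow> (M + 1) * \<bar>s - s\<bar>) (at s)"
      by (intro tendsto_intros)
    then have "((\<lambda>t. dist (z s) (z t)) \<longlongrightarrow> 0) (at s)"
      by (intro Lim_null_comparison[OF ev]) simp
    then show ?thesis unfolding isCont_def by (subst tendsto_dist_iff) (simp add: dist_commute)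
  qed
  then have "continuous_on UNIV (\<lambda>t. h (z t))"
    using zS by (intro continuous_on_compose2[OF h]) (auto intro: continuous_at_imp_continuous_on)
  have "(z has_vector_derivative h (z s)) (at s)" for s
    unfolding has_vector_derivative_def has_derivative_at_alt
  proof (intro conjI allI impI bounded_linear_scaleR_left)
    fix e :: real assume "e > 0"
    obtain d where d: "d > 0" "\<And>t. dist t s < d \<Longrightarrow> dist (h (z t)) (h (z s)) < e / 2"
      using \<open>continuous_on UNIV (\<lambda>t. h (z t))\<close> \<open>e > 0\<close> unfolding continuous_on_iff
      by (metis UNIV_I half_gt_zero)
    obtain \<delta> where \<delta>: "\<delta> > 0"
      "\<And>s t. t \<in> {s..s + \<delta>} \<Longrightarrow> norm (z t - z s - (t - s) *\<^sub>R h (z s)) \<le> e / 2 * (t - s)"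
      using est[of "e / 2"] \<open>e > 0\<close> by auto
    have "norm (z t - z s - (t - s) *\<^sub>R h (z s)) \<le> e * norm (t - s)" if t: "norm (t - s) < min d \<delta>" for t
    proof (cases "s \<le> t")
      case True
      have "norm (z t - z s - (t - s) *\<^sub>R h (z s)) \<le> e / 2 * (t - s)"
        using t True by (intro \<delta>) auto
      also have "\<dots> \<le> e * norm (t - s)"
        using True \<open>e > 0\<close> by (intro mult_mono) auto
      finally show ?thesis .
    next
      case False
      \<comment> \<open>The estimate only looks forward in time: start from \<open>t\<close>, then replace \<open>h (z t)\<close> by
        \<open>h (z s)\<close> using continuity.\<close>
      have "z t - z s - (t - s) *\<^sub>R h (z s)
          = (s - t) *\<^sub>R (h (z s) - h (z t)) - (z s - z t - (s - t) *\<^sub>R h (z t))"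
        by (simp add: algebra_simps)
      also have "norm \<dots> \<le> norm ((s - t) *\<^sub>R (h (z s) - h (z t)))
          + norm (z s - z t - (s - t) *\<^sub>R h (z t))"
        by (rule norm_triangle_ineq4)
      also have "\<dots> \<le> (s - t) * (e / 2) + e / 2 * (s - t)"
      proof (rule add_mono)
        show "norm ((s - t) *\<^sub>R (h (z s) - h (z t))) \<le> (s - t) * (e / 2)"
          using d(2)[of t] False t
          by (auto simp: dist_norm norm_minus_commute intro!: mult_left_mono)
        show "norm (z s - z t - (s - t) *\<^sub>R h (z t)) \<le> e / 2 * (s - t)"
          using t False by (intro \<delta>) auto
      qed
      also have "\<dots> = e * norm (t - s)" using False by (simp add: field_simps)
      finally show ?thesis .
    qed
    then show "\<exists>d>0. \<forall>t. norm (t - s) < d \<longrightarrow> norm (z t - z s - (t - s) *\<^sub>R h (z s)) \<le> e * norm (t - s)"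
      using d(1) \<delta>(1) by (intro exI[of _ "min d \<delta>"]) auto
  qed
  with zS z0 show ?thesis unfolding global_ode_solution_def by blast
qed

section \<open>Cesaro negligible noise over windows of bounded length\<close>

text \<open>
  Summation by parts gives \<open>\<Sum> a i * \<gamma> i = a n * G n - a m * G m + \<Sum> (a i - a (i + 1)) * G (i + 1)\<close> for the
  partial sums \<open>G\<close> of \<open>\<gamma>\<close>. Monotonicity of \<open>a\<close> makes the weights \<open>a i - a (i + 1)\<close> nonnegative, so each
  \<open>G k\<close> may be replaced by its bound \<open>\<epsilon> * k\<close>, and the same identity with \<open>\<gamma> = 1\<close> evaluates the last
  sum again.
\<close>
lemma weighted_sum_bound:
  fixes \<gamma> :: "nat \<Rightarrow> 'a::real_normed_vector"
  assumes a: "decseq a" "\<And>i. a i \<ge> 0" and "m \<le> n"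
    and G: "\<And>k. m \<le> k \<Longrightarrow> norm (\<Sum>i<k. \<gamma> i) \<le> \<epsilon> * real k"
  shows "norm (\<Sum>i=m..<n. a i *\<^sub>R \<gamma> i) \<le> \<epsilon> * ((\<Sum>i=m..<n. a i) + 2 * (real m * a m))"
proof -
  define G where "G k = (\<Sum>i<k. \<gamma> i)" for k
  have "norm ((\<Sum>i=m..<n. a i *\<^sub>R \<gamma> i) - a n *\<^sub>R G n + a m *\<^sub>R G m)
      \<le> \<epsilon> * ((\<Sum>i=m..<n. a i) - real n * a n + real m * a m)"
    using \<open>m \<le> n\<close>
  proof (induction n rule: dec_induct)
    case base
    then show ?case by simp
  next
    case (step n)
    have "(\<Sum>i=m..<Suc n. a i *\<^sub>R \<gamma> i) - a (Suc n) *\<^sub>R G (Suc n) + a m *\<^sub>R G m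
        = ((\<Sum>i=m..<n. a i *\<^sub>R \<gamma> i) - a n *\<^sub>R G n + a m *\<^sub>R G m) + (a n - a (Suc n)) *\<^sub>R G (Suc n)"
      using step by (simp add: G_def algebra_simps)
    also have "norm \<dots> \<le> \<epsilon> * ((\<Sum>i=m..<n. a i) - real n * a n + real m * a m)
        + (a n - a (Suc n)) * (\<epsilon> * real (Suc n))"
    proof (rule norm_triangle_le[OF add_mono[OF step.IH]])
      show "norm ((a n - a (Suc n)) *\<^sub>R G (Suc n)) \<le> (a n - a (Suc n)) * (\<epsilon> * real (Suc n))"
        using G[of "Suc n"] step decseqD[OF a(1), of n "Suc n"]
        by (auto simp: G_def simp del: sum.lessThan_Suc intro!: mult_left_mono)
    qed
    also have "\<dots> = \<epsilon> * ((\<Sum>i=m..<Suc n. a i) - real (Suc n) * a (Suc n) + real m * a m)"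
      using step by (simp add: algebra_simps)
    finally show ?case .
  qed
  moreover have "norm (a n *\<^sub>R G n) \<le> a n * (\<epsilon> * real n)" "norm (a m *\<^sub>R G m) \<le> a m * (\<epsilon> * real m)"
    using G \<open>m \<le> n\<close> by (auto simp: G_def a intro!: mult_left_mono)
  moreover have "norm (\<Sum>i=m..<n. a i *\<^sub>R \<gamma> i)
      \<le> norm ((\<Sum>i=m..<n. a i *\<^sub>R \<gamma> i) - a n *\<^sub>R G n + a m *\<^sub>R G m) + (norm (a n *\<^sub>R G n) + norm (a m *\<^sub>R G m))"
    by (smt (verit, best) norm_triangle_ineq4 norm_triangle_ineq add_diff_cancel diff_add_cancel)
  ultimately show ?thesis by (simp add: algebra_simps)
qed

lemma cesaro_negligible_partial_sums:
  assumes "cesaro_negligible \<gamma>" "\<epsilon> > 0"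
  shows "\<forall>\<^sub>F k in sequentially. norm (\<Sum>i<k. \<gamma> i) \<le> \<epsilon> * real k"
proof -
  have "\<forall>\<^sub>F n in sequentially. norm ((1 / real n) *\<^sub>R (\<Sum>i=0..n. \<gamma> i)) < \<epsilon>"
    using assms unfolding cesaro_negligible_def by (auto simp: tendsto_iff)
  with eventually_gt_at_top[of 0]
  have "\<forall>\<^sub>F n in sequentially. norm (\<Sum>i<Suc n. \<gamma> i) \<le> \<epsilon> * real (Suc n)"
  proof eventually_elim
    case (elim n)
    then have "norm (\<Sum>i<Suc n. \<gamma> i) \<le> \<epsilon> * real n"
      by (simp add: atLeast0AtMost lessThan_Suc_atMost field_simps del: sum.lessThan_Suc)
    also have "\<dots> \<le> \<epsilon> * real (Suc n)" using \<open>\<epsilon> > 0\<close> by simp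
    finally show ?case .
  qed
  then show ?thesis by (subst (asm) eventually_sequentially_Suc)
qed


lemma discounted_noise_window:
  fixes \<gamma> :: "nat \<Rightarrow> 'a::real_normed_vector"
  assumes a: "decseq a" "\<And>i. a i \<ge> 0" and C: "\<forall>\<^sub>F n in sequentially. real n * a n \<le> C"
    and "cesaro_negligible \<gamma>" and "\<eta> > 0"
  shows "\<forall>\<^sub>F m in sequentially. \<forall>n\<ge>m. (\<Sum>i=m..<n. a i) \<le> T \<longrightarrow> norm (\<Sum>i=m..<n. a i *\<^sub>R \<gamma> i) \<le> \<eta>"
proof -
  define B where "B = \<bar>T\<bar> + 2 * \<bar>C\<bar> + 1"
  have "B > 0" by (simp add: B_def)
  then obtain k0 where k0: "\<And>k. k \<ge> k0 \<Longrightarrow> norm (\<Sum>i<k. \<gamma> i) \<le> \<eta> / B * real k"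
    using cesaro_negligible_partial_sums[OF assms(4), of "\<eta> / B"] \<open>\<eta> > 0\<close>
    unfolding eventually_sequentially by auto
  show ?thesis
    using C eventually_ge_at_top[of k0]
  proof eventually_elim
    case (elim m)
    show ?case
    proof (intro allI impI)
      fix n assume "m \<le> n" and T: "(\<Sum>i=m..<n. a i) \<le> T"
      have "norm (\<Sum>i=m..<n. a i *\<^sub>R \<gamma> i) \<le> \<eta> / B * ((\<Sum>i=m..<n. a i) + 2 * (real m * a m))"
        using k0 elim by (intro weighted_sum_bound a \<open>m \<le> n\<close>) auto
      also have "\<dots> \<le> \<eta> / B * B"
        using T elim \<open>\<eta> > 0\<close> \<open>B > 0\<close> by (intro mult_left_mono) (auto simp: B_def)
      finally show "norm (\<Sum>i=m..<n. a i *\<^sub>R \<gamma> i) \<le> \<eta>" using \<open>B > 0\<close> by simp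
    qed
  qed
qed

section \<open>The noisy Euler scheme as an asymptotic solution\<close>

text \<open>
  Within a short window late in the sequence, \<open>x\<close> moves by at most \<open>M * \<delta>\<close> plus noise, so by uniform
  continuity \<open>h (x i)\<close> stays within \<open>\<epsilon>\<close> of \<open>h (x m)\<close>, and the drift is \<open>h (x m)\<close> times the length of the
  window up to a relative error \<open>\<epsilon>\<close>.
\<close>
lemma noisy_euler_window:
  fixes x \<gamma> :: "nat \<Rightarrow> 'a::real_normed_vector"
  assumes S: "compact S" and h: "continuous_on S h" and a: "\<And>i. a i \<ge> 0"
    and noise: "\<And>\<eta>. \<eta> > 0 \<Longrightarrow> \<forall>\<^sub>F m in sequentially. \<forall>n\<ge>m. (\<Sum>i=m..<n. a i) \<le> 1 \<longrightarrow>
                  norm (\<Sum>i=m..<n. a i *\<^sub>R \<gamma> i) \<le> \<eta>"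
    and xS: "\<And>n. x n \<in> S"
    and x: "\<And>n. x (Suc n) = x n + a n *\<^sub>R h (x n) + a n *\<^sub>R \<gamma> n"
    and "\<epsilon> > 0"
  shows "\<exists>\<delta>>0. \<forall>\<eta>>0. \<forall>\<^sub>F m in sequentially. \<forall>n\<ge>m. (\<Sum>i=m..<n. a i) \<le> \<delta> \<longrightarrow>
           norm (x n - x m - (\<Sum>i=m..<n. a i) *\<^sub>R h (x m)) \<le> \<epsilon> * (\<Sum>i=m..<n. a i) + \<eta>"
proof -
  obtain M where M: "M > 0" "\<And>v. v \<in> S \<Longrightarrow> norm (h v) \<le> M"
    using compact_imp_bounded[OF compact_continuous_image[OF h S]] by (auto simp: bounded_pos)
  obtain \<rho> where \<rho>: "\<rho> > 0" "\<And>v w. v \<in> S \<Longrightarrow> w \<in> S \<Longrightarrow> dist w v < \<rho> \<Longrightarrow> dist (h w) (h v) < \<epsilon>"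
    using compact_uniformly_continuous[OF h S] \<open>\<epsilon> > 0\<close> unfolding uniformly_continuous_on_def by metis
  have sum: "x n - x m = (\<Sum>i=m..<n. a i *\<^sub>R h (x i)) + (\<Sum>i=m..<n. a i *\<^sub>R \<gamma> i)" if "m \<le> n" for m n
    using that by (induction n rule: dec_induct) (auto simp: x algebra_simps)
  \<comment> \<open>Drift of at most \<open>\<rho> / 4\<close> and noise of at most \<open>\<rho> / 2\<close> keep a window strictly within \<open>\<rho>\<close>.\<close>
  define \<delta> where "\<delta> = min 1 (\<rho> / (4 * M))"
  have \<delta>: "\<delta> > 0" "\<delta> \<le> 1" "M * \<delta> \<le> \<rho> / 4"
    using \<rho>(1) M(1) by (auto simp: \<delta>_def min_def field_simps)
  have "\<forall>\<^sub>F m in sequentially. \<forall>n\<ge>m. (\<Sum>i=m..<n. a i) \<le> \<delta> \<longrightarrow>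
           norm (x n - x m - (\<Sum>i=m..<n. a i) *\<^sub>R h (x m)) \<le> \<epsilon> * (\<Sum>i=m..<n. a i) + \<eta>"
    if "\<eta> > 0" for \<eta>
  proof -
    have "min \<eta> (\<rho> / 2) > 0" using \<rho>(1) \<open>\<eta> > 0\<close> by simp
    from noise[OF this] show ?thesis
    proof eventually_elim
      case (elim m)
      show ?case
      proof (intro allI impI)
        fix n assume "m \<le> n" and n: "(\<Sum>i=m..<n. a i) \<le> \<delta>"
        have window: "(\<Sum>i=m..<j. a i) \<le> \<delta>" if "j \<in> {m..n}" for j
          using that n by (intro order_trans[OF sum_mono2 n]) (auto simp: a)
        have near: "norm (h (x j) - h (x m)) \<le> \<epsilon>" if j: "j \<in> {m..<n}" for j
        proof -
          have "m \<le> j" using j by simp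
          have "norm (\<Sum>i=m..<j. a i *\<^sub>R h (x i)) \<le> (\<Sum>i=m..<j. a i * M)"
            by (intro sum_norm_le) (auto simp: a M xS intro!: mult_left_mono)
          also have "\<dots> = M * (\<Sum>i=m..<j. a i)" by (simp add: sum_distrib_left mult.commute)
          also have "\<dots> \<le> M * \<delta>" using window[of j] j M by (intro mult_left_mono) auto
          finally have "norm (\<Sum>i=m..<j. a i *\<^sub>R h (x i)) \<le> \<rho> / 4" using \<delta> by linarith
          moreover have "norm (\<Sum>i=m..<j. a i *\<^sub>R \<gamma> i) \<le> \<rho> / 2"
            using elim[rule_format, of j] window[of j] j \<delta> by auto
          ultimately have "norm (x j - x m) \<le> \<rho> / 4 + \<rho> / 2"
            unfolding sum[OF \<open>m \<le> j\<close>] by (rule norm_triangle_mono)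
          then have "dist (x j) (x m) < \<rho>" using \<rho>(1) by (simp add: dist_norm)
          then show ?thesis using \<rho>(2)[OF xS xS] by (simp add: dist_norm less_imp_le)
        qed
        have "x n - x m - (\<Sum>i=m..<n. a i) *\<^sub>R h (x m)
            = (\<Sum>i=m..<n. a i *\<^sub>R (h (x i) - h (x m))) + (\<Sum>i=m..<n. a i *\<^sub>R \<gamma> i)"
          using sum[OF \<open>m \<le> n\<close>] by (simp add: scaleR_sum_left scaleR_diff_right sum_subtractf)
        also have "norm \<dots> \<le> \<epsilon> * (\<Sum>i=m..<n. a i) + \<eta>"
        proof (rule norm_triangle_le[OF add_mono])
          have "norm (\<Sum>i=m..<n. a i *\<^sub>R (h (x i) - h (x m))) \<le> (\<Sum>i=m..<n. a i * \<epsilon>)"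
            by (intro sum_norm_le) (auto simp: a near intro!: mult_left_mono)
          then show "norm (\<Sum>i=m..<n. a i *\<^sub>R (h (x i) - h (x m))) \<le> \<epsilon> * (\<Sum>i=m..<n. a i)"
            by (simp add: sum_distrib_left mult.commute)
          show "norm (\<Sum>i=m..<n. a i *\<^sub>R \<gamma> i) \<le> \<eta>"
            using elim \<open>m \<le> n\<close> n \<delta> by auto
        qed
        finally show "norm (x n - x m - (\<Sum>i=m..<n. a i) *\<^sub>R h (x m)) \<le> \<epsilon> * (\<Sum>i=m..<n. a i) + \<eta>" .
      qed
    qed
  qed
  then show ?thesis using \<delta>(1) by blast
qed

text \<open>
  Rounding up to the next clock tick makes the index of the \<open>n\<close>-th tick exactly \<open>n\<close>. Times before the first tick
  get index \<open>0\<close>, so a process read off along this index is defined on the whole real line.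
\<close>
definition clock_index :: "(nat \<Rightarrow> real) \<Rightarrow> real \<Rightarrow> nat" where
  "clock_index a t = (LEAST n. t \<le> (\<Sum>i<n. a i))"

context
  fixes a :: "nat \<Rightarrow> real"
  assumes pos: "\<And>n. a n > 0" and diverge: "filterlim (\<lambda>n. \<Sum>i<n. a i) at_top sequentially"
begin

lemma clock_strict_mono: "strict_mono (\<lambda>n. \<Sum>i<n. a i)"
  using pos by (intro strict_monoI_Suc) simp

lemma le_clock: "t \<le> (\<Sum>i<clock_index a t. a i)"
proof -
  obtain n where "t \<le> (\<Sum>i<n. a i)"
    using eventually_happens[OF diverge[unfolded filterlim_at_top, rule_format, of t]] by auto
  then show ?thesis unfolding clock_index_def by (rule LeastI)
qed

lemma clock_index_clock: "clock_index a (\<Sum>i<n. a i) = n"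
  unfolding clock_index_def
  using strict_mono_less_eq[OF clock_strict_mono] by (intro Least_equality) auto

lemma clock_index_mono: "s \<le> t \<Longrightarrow> clock_index a s \<le> clock_index a t"
  using le_clock[of t] by (subst (1) clock_index_def) (auto intro: Least_le)

lemma filterlim_clock_index: "filterlim (clock_index a) sequentially at_top"
  unfolding filterlim_at_top
proof
  fix n
  show "\<forall>\<^sub>F t in at_top. n \<le> clock_index a t"
    using eventually_ge_at_top[of "\<Sum>i<n. a i"]
    by eventually_elim (metis clock_index_clock clock_index_mono)
qed

lemma eventually_clock_le:
  assumes "a \<longlonglongrightarrow> 0" and "\<kappa> > 0"
  shows "\<forall>\<^sub>F t in at_top. (\<Sum>i<clock_index a t. a i) \<le> t + \<kappa>"
proof -
  obtain n1 where n1: "\<And>n. n \<ge> n1 \<Longrightarrow> a n < \<kappa>"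
    using order_tendstoD(2)[OF assms] unfolding eventually_sequentially by auto
  have "\<forall>\<^sub>F t in at_top. Suc n1 \<le> clock_index a t"
    using filterlim_clock_index unfolding filterlim_at_top by blast
  then show ?thesis
  proof eventually_elim
    case (elim t)
    then obtain k where k: "clock_index a t = Suc k" "k \<ge> n1"
      by (cases "clock_index a t") auto
    have "\<not> t \<le> (\<Sum>i<k. a i)"
      using not_less_Least[of k "\<lambda>n. t \<le> (\<Sum>i<n. a i)"] k by (simp add: clock_index_def)
    then show ?case using n1[of k] k by simp
  qed
qed

text \<open>
  Late clock ticks are at most \<open>\<kappa>\<close> apart, so the elapsed time \<open>t - s\<close> and the clock length of the
  corresponding window of indices differ by at most \<open>\<kappa>\<close>. The discrete estimate therefore carries over
  at a cost of order \<open>\<kappa>\<close>, which is absorbed in \<open>\<eta>\<close>.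
\<close>
lemma noisy_euler_pseudotrajectory:
  fixes x :: "nat \<Rightarrow> 'a::real_normed_vector"
  assumes S: "compact S" and h: "continuous_on S h" and null: "a \<longlonglongrightarrow> 0"
    and noise: "\<And>\<eta>. \<eta> > 0 \<Longrightarrow> \<forall>\<^sub>F m in sequentially. \<forall>n\<ge>m. (\<Sum>i=m..<n. a i) \<le> 1 \<longrightarrow>
                  norm (\<Sum>i=m..<n. a i *\<^sub>R \<gamma> i) \<le> \<eta>"
    and xS: "\<And>n. x n \<in> S"
    and x: "\<And>n. x (Suc n) = x n + a n *\<^sub>R h (x n) + a n *\<^sub>R \<gamma> n"
  shows "euler_pseudotrajectory h (\<lambda>t. x (clock_index a t))"
  unfolding euler_pseudotrajectory_def
proof (intro allI impI)
  fix \<epsilon> :: real assume "\<epsilon> > 0"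
  obtain M where M: "M > 0" "\<And>v. v \<in> S \<Longrightarrow> norm (h v) \<le> M"
    using compact_imp_bounded[OF compact_continuous_image[OF h S]] by (auto simp: bounded_pos)
  obtain \<delta> where "\<delta> > 0" and \<delta>: "\<And>\<eta>. \<eta> > 0 \<Longrightarrow> \<forall>\<^sub>F m in sequentially. \<forall>n\<ge>m.
      (\<Sum>i=m..<n. a i) \<le> \<delta> \<longrightarrow>
      norm (x n - x m - (\<Sum>i=m..<n. a i) *\<^sub>R h (x m)) \<le> \<epsilon> * (\<Sum>i=m..<n. a i) + \<eta>"
    using noisy_euler_window[where a = a and \<gamma> = \<gamma> and x = x, OF S h less_imp_le[OF pos] noise xS x \<open>\<epsilon> > 0\<close>] by blast
  have "\<forall>\<^sub>F s in at_top. \<forall>t\<in>{s..s + \<delta> / 2}.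
      norm (x (clock_index a t) - x (clock_index a s) - (t - s) *\<^sub>R h (x (clock_index a s)))
        \<le> \<epsilon> * (t - s) + \<eta>" if "\<eta> > 0" for \<eta>
  proof -
    \<comment> \<open>The first bound keeps the length of index windows at most \<open>\<delta>\<close>; the second makes the total
      rounding error \<open>\<epsilon> * \<kappa> + M * \<kappa>\<close> at most \<open>\<eta> / 2\<close>.\<close>
    define \<kappa> where "\<kappa> = min (\<delta> / 2) (\<eta> / (2 * (\<epsilon> + M)))"
    have "\<epsilon> + M > 0" using \<open>\<epsilon> > 0\<close> M by simp
    have "(\<epsilon> + M) * \<kappa> \<le> (\<epsilon> + M) * (\<eta> / (2 * (\<epsilon> + M)))"
      using \<open>\<epsilon> + M > 0\<close> by (intro mult_left_mono) (auto simp: \<kappa>_def)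
    also have "\<dots> = \<eta> / 2" using \<open>\<epsilon> + M > 0\<close> by (simp add: divide_simps)
    finally have "(\<epsilon> + M) * \<kappa> \<le> \<eta> / 2" .
    moreover have "\<kappa> > 0"
      using \<open>\<eta> > 0\<close> \<open>\<delta> > 0\<close> \<open>\<epsilon> + M > 0\<close> by (auto simp: \<kappa>_def)
    moreover have "\<kappa> \<le> \<delta> / 2"
      unfolding \<kappa>_def by (rule min.cobounded1)
    ultimately have \<kappa>: "\<kappa> > 0" "\<kappa> \<le> \<delta> / 2" "(\<epsilon> + M) * \<kappa> \<le> \<eta> / 2"
      by blast+
    obtain s0 where s0: "\<And>t. t \<ge> s0 \<Longrightarrow> (\<Sum>i<clock_index a t. a i) \<le> t + \<kappa>"
      using eventually_clock_le[OF null \<kappa>(1)] unfolding eventually_at_top_linorder by blast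
    have "\<eta> / 2 > 0" using \<open>\<eta> > 0\<close> by simp
    from eventually_compose_filterlim[OF \<delta>[OF this] filterlim_clock_index] eventually_ge_at_top[of s0]
    show ?thesis
    proof eventually_elim
      case (elim s)
      show ?case
      proof
        fix t assume t: "t \<in> {s..s + \<delta> / 2}"
        define m n where "m = clock_index a s" and "n = clock_index a t"
        define A where "A = (\<Sum>i=m..<n. a i)"
        have "m \<le> n" using clock_index_mono t by (auto simp: m_def n_def)
        then have "A = (\<Sum>i<n. a i) - (\<Sum>i<m. a i)"
          unfolding A_def by (metis atLeast0LessThan sum_diff_nat_ivl zero_le)
        moreover have "s \<le> (\<Sum>i<m. a i)" "(\<Sum>i<m. a i) \<le> s + \<kappa>" "t \<le> (\<Sum>i<n. a i)" "(\<Sum>i<n. a i) \<le> t + \<kappa>"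
          using le_clock s0 elim(2) t by (auto simp: m_def n_def)
        ultimately have A: "\<bar>A - (t - s)\<bar> \<le> \<kappa>" by linarith
        then have "A \<le> \<delta>" using t \<kappa>(2) by auto
        have "x n - x m - (t - s) *\<^sub>R h (x m) = (x n - x m - A *\<^sub>R h (x m)) + (A - (t - s)) *\<^sub>R h (x m)"
          by (simp add: algebra_simps)
        also have "norm \<dots> \<le> (\<epsilon> * A + \<eta> / 2) + \<kappa> * M"
        proof (rule norm_triangle_le[OF add_mono])
          show "norm (x n - x m - A *\<^sub>R h (x m)) \<le> \<epsilon> * A + \<eta> / 2"
            using elim(1) \<open>m \<le> n\<close> \<open>A \<le> \<delta>\<close> by (auto simp: A_def m_def)
          show "norm ((A - (t - s)) *\<^sub>R h (x m)) \<le> \<kappa> * M"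
            using A \<kappa>(1) by (auto intro!: mult_mono M xS)
        qed
        also have "\<epsilon> * A \<le> \<epsilon> * (t - s + \<kappa>)"
          using A \<open>\<epsilon> > 0\<close> by (intro mult_left_mono) auto
        also have "\<epsilon> * (t - s + \<kappa>) + \<eta> / 2 + \<kappa> * M \<le> \<epsilon> * (t - s) + \<eta>"
          using \<kappa>(3) by (simp add: algebra_simps)
        finally show "norm (x (clock_index a t) - x (clock_index a s) - (t - s) *\<^sub>R h (x (clock_index a s)))
            \<le> \<epsilon> * (t - s) + \<eta>"
          by (simp add: m_def n_def)
      qed
    qed
  qed
  then show "\<exists>\<delta>>0. \<forall>\<eta>>0. \<forall>\<^sub>F s in at_top. \<forall>t\<in>{s..s + \<delta>}.
      norm (x (clock_index a t) - x (clock_index a s) - (t - s) *\<^sub>R h (x (clock_index a s)))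
        \<le> \<epsilon> * (t - s) + \<eta>"
    using \<open>\<delta> > 0\<close> half_gt_zero by blast
qed

end

section \<open>Step sizes of harmonic order\<close>

lemma harmonic_lower_bound_imp_diverges:
  fixes a :: "nat \<Rightarrow> real"
  assumes pos: "\<And>n. a n > 0" and "c > 0" and c: "\<forall>\<^sub>F n in sequentially. c \<le> real n * a n"
  shows "filterlim (\<lambda>n. \<Sum>i<n. a i) at_top sequentially"
proof -
  have "\<not> summable a"
  proof
    assume "summable a"
    have "\<forall>\<^sub>F n in sequentially. norm (inverse (real n)) \<le> a n / c"
      using c eventually_gt_at_top[of 0]
      by eventually_elim (use \<open>c > 0\<close> in \<open>simp add: field_simps\<close>)
    then have "summable (\<lambda>n. inverse (real n))"
      by (rule summable_comparison_test_ev) (intro summable_divide \<open>summable a\<close>)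
    then show False using not_summable_harmonic[where 'a = real] by simp
  qed
  then have unbounded: "\<exists>n. (\<Sum>i<n. a i) > B" for B
    using summableI_nonneg_bounded[of a B] pos by (meson less_imp_le not_less)
  show ?thesis
    unfolding filterlim_at_top
  proof
    fix B
    obtain n where "(\<Sum>i<n. a i) > B" using unbounded by blast
    moreover have "(\<Sum>i<n. a i) \<le> (\<Sum>i<m. a i)" if "n \<le> m" for m
      using that pos by (intro sum_mono2) (auto simp: less_imp_le)
    ultimately show "\<forall>\<^sub>F m in sequentially. B \<le> (\<Sum>i<m. a i)"
      unfolding eventually_sequentially by (meson less_imp_le order_trans)
  qed
qed

lemma harmonic_upper_bound_imp_null:
  fixes a :: "nat \<Rightarrow> real"
  assumes pos: "\<And>n. a n > 0" and C: "\<forall>\<^sub>F n in sequentially. real n * a n \<le> C"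
  shows "a \<longlonglongrightarrow> 0"
proof (rule Lim_null_comparison)
  show "\<forall>\<^sub>F n in sequentially. norm (a n) \<le> C / real n"
    using C eventually_gt_at_top[of 0]
    by eventually_elim (use pos in \<open>simp add: field_simps less_imp_le\<close>)
  show "(\<lambda>n. C / real n) \<longlonglongrightarrow> 0" by (rule lim_const_over_n)
qed

section \<open>Convergence\<close>

theorem theorem3p1:
  fixes S :: "(real ^ 'k) set"
    and h :: "real ^ 'k \<Rightarrow> real ^ 'k"
    and a :: "nat \<Rightarrow> real"
    and \<gamma> x :: "nat \<Rightarrow> real ^ 'k"
    and z :: "real \<Rightarrow> real ^ 'k"
  assumes "compact S" and "convex S"
    and "continuous_on S h"
    and "decseq a" and "\<And>n. a n > 0"
    and "0 < liminf (\<lambda>n. ereal (real n * a n))"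
    and "limsup (\<lambda>n. ereal (real n * a n)) < \<infinity>"
    and "cesaro_negligible \<gamma>"
    and "\<And>n. x n \<in> S"
    and "\<And>n. x (Suc n) = x n + a n *\<^sub>R h (x n) + a n *\<^sub>R \<gamma> n"
    and "global_ode_solution S h z"
    and "\<And>w. global_ode_solution S h w \<Longrightarrow> w = z"
  shows "x \<longlonglongrightarrow> z 0"
proof -
  define \<tau> where "\<tau> n = (\<Sum>i<n. a i)" for n
  define Y where "Y = (\<lambda>t. x (clock_index a t))"
  obtain c where c: "c > 0" "\<forall>\<^sub>F n in sequentially. c \<le> real n * a n"
  proof -
    obtain c where c: "ereal 0 < ereal c" "ereal c < liminf (\<lambda>n. ereal (real n * a n))"
      using ereal_dense2[of 0] assms(6) by (auto simp: zero_ereal_def)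
    show ?thesis
      using less_LiminfD[OF c(2)] c(1) by (intro that[of c]) (auto elim: eventually_mono)
  qed
  obtain C where C: "\<forall>\<^sub>F n in sequentially. real n * a n \<le> C"
  proof -
    obtain C where "limsup (\<lambda>n. ereal (real n * a n)) < ereal C"
      using ereal_dense2[OF assms(7)] by blast
    from Limsup_lessD[OF this] show ?thesis
      by (intro that[of C]) (auto elim: eventually_mono)
  qed
  have diverge: "filterlim \<tau> at_top sequentially"
    unfolding \<tau>_def using harmonic_lower_bound_imp_diverges[OF assms(5) c] .
  note noise = discounted_noise_window[OF assms(4) less_imp_le[OF assms(5)] C assms(8)]
  have Y: "euler_pseudotrajectory h Y"
    unfolding Y_def
    by (rule noisy_euler_pseudotrajectory[where S = S and \<gamma> = \<gamma>])
      (fact assms diverge[unfolded \<tau>_def] harmonic_upper_bound_imp_null[OF assms(5) C] noise)+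
  have YS: "Y t \<in> S" for t by (simp add: Y_def assms(9))
  have Y\<tau>: "Y (\<tau> n) = x n" for n
    by (simp add: Y_def \<tau>_def clock_index_clock[OF assms(5) diverge[unfolded \<tau>_def]])
  have limit_point: "y = z 0" if "strict_mono r" "(\<lambda>k. x (r k)) \<longlonglongrightarrow> y" for r y
  proof -
    have "filterlim (\<lambda>k. \<tau> (r k)) at_top sequentially"
      using filterlim_compose[OF diverge filterlim_subseq[OF \<open>strict_mono r\<close>]] .
    then have "\<exists>w. global_ode_solution S h w \<and> w 0 = y"
      by (rule limit_point_of_pseudotrajectory_on_solution[OF assms(1,3) Y YS]) (simp add: Y\<tau> that)
    then show ?thesis using assms(12) by blast
  qed
  show ?thesis
  proof (rule ccontr)
    assume "\<not> x \<longlonglongrightarrow> z 0"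
    then obtain U where U: "open U" "z 0 \<in> U" "\<exists>\<^sub>F n in sequentially. x n \<notin> U"
      unfolding tendsto_def by (auto simp: frequently_def)
    define r where "r = enumerate {n. x n \<notin> U}"
    have "infinite {n. x n \<notin> U}"
      using U(3) unfolding cofinite_eq_sequentially[symmetric] frequently_cofinite .
    from strict_mono_enumerate[OF this] enumerate_in_set[OF this]
    have r: "strict_mono r" "\<And>k. x (r k) \<notin> U"
      unfolding r_def by simp_all
    have "\<forall>k. (x \<circ> r) k \<in> S" by (simp add: assms(9))
    then obtain y r' where r': "strict_mono r'" "((x \<circ> r) \<circ> r') \<longlonglongrightarrow> y"
      by (rule seq_compactE[OF compact_imp_seq_compact[OF assms(1)]])
    have y: "y = z 0"
      using limit_point[OF strict_mono_o[OF r(1) r'(1)]] r'(2) by (simp add: o_def)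
    have "\<forall>\<^sub>F k in sequentially. ((x \<circ> r) \<circ> r') k \<in> U"
      using topological_tendstoD[OF r'(2)[unfolded y] U(1,2)] .
    from eventually_happens[OF this] show False using r(2) by simp
  qed
qed

end
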